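(* Let $F:[0,1]\to[0,1]$ be an admissible parabolic map (as defined in the context), with parameter $s>0$ at the indifferent fixed point and invariant measure $\mu$. Let $c_s>0$ be the constant, depending only on the system, such that for the Markov holes $H_N=[0,a_N]$, as $N\to\infty$, $\gamma_\mu(H_N)\sim c_s\,m(H_N)$ if $s\in(0,1)$, $\gamma_\mu(H_N)\sim c_s\,\frac{m(H_N)}{-\log m(H_N)}$ if $s=1$, and $\gamma_\mu(H_N)\sim c_s\,m(H_N)^s$ if $s>1$. For $\varepsilon>0$ let $H_\varepsilon:=[0,\varepsilon]$. Then, as $\varepsilon\to0^+$, $$\gamma_\mu(H_\varepsilon)\sim\begin{cases}c_s\cdot m(H_\varepsilon),&\text{if } s\in(0,1);\\[0.1cm] c_s\cdot\dfrac{m(H_\varepsilon)}{-\log m(H_\varepsilon)},&\text{if } s=1;\\[0.2cm] c_s\cdot m(H_\varepsilon)^s,&\text{if } s>1.\end{cases}$$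
   Context: **Parabolic maps.** $m$ is Lebesgue measure on $[0,1]$. Consider maps $F:[0,1]\to[0,1]$ such that: (H1) for some $a\in(0,1)$, with $J_0:=[0,a]$, $J_1:=(a,1]$, $F$ is monotone on each of $J_0,J_1$ and has full branches: $F(J_0)=\overline{F(J_1)}=[0,1]$. (H2) for some $r\in\mathbb N\cup\{\infty\}$, $r\ge1$, $F_0:=F|_{J_0}$ is $C^r$ on $(0,a)$ and extends to a $C^r$ function on $(0,a]$, and $F_1:=F|_{J_1}$ is $C^r$ on $(a,1)$ and extends to a $C^r$ function on $[a,1]$. Let $\phi_i:=F_i^{-1}$ be the local inverses (extended by continuity to $[0,1]$). (H3) $F(0)=0$ and $F'(x)-1\sim c\,x^s$ as $x\to0^+$ for some $c>0$, $s>0$. (H4) there are $\varepsilon_0>0$, $\beta>1$ such that $F'$ is increasing on $(0,\varepsilon_0)$ and $|F'(x)|\ge\beta$ for all $x\ge\varepsilon_0$. (H5) $F$ admits a unique ergodic conservative invariant measure $\mu$ (finite or $\sigma$-finite infinite) equivalent to $m$, in the sense that $\mu$ is absolutely continuous with density bounded away from $0$. Put $a_0:=1$, $a_1:=a$, $a_n:=\phi_0(a_{n-1})$ for $n\ge2$ (a sequence decreasing to $0$). A Markov hole is an interval $[0,a_N]$ with $N\ge2$. **Symbolic representation.** $\Omega=\{0,1\}^{\mathbb N_0}$ with left shift $T$. The coding $\pi:\Omega\to[0,1]$ is $\pi(\omega)=x$ iff $F^i(x)\in J_{\omega_i}$ for all $i\ge0$, extended by continuity to the countably many strings not arising in this way.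 Let $\tau_0(\omega)=1+\inf\{i\ge0:\omega_i=1\}$, $\tau_k(\omega)=1+\inf\{i\ge\tau_{k-1}(\omega):\omega_i=1\}$ for $k\ge1$, let $0^\infty$ be the constant string of zeros, $\Omega_0:=\Omega\setminus\bigcup_{i\ge0}T^{-i}(0^\infty)$, $\sigma_0=\tau_0$, $\sigma_k=\tau_k-\tau_{k-1}$. Let $\Sigma=\mathbb N^{\mathbb N_0}$ ($\mathbb N=\{1,2,\dots\}$), $[n]:=\{\sigma\in\Sigma:\sigma_0=n\}$, and let $\iota:\Omega_0\to\Sigma$ be the homeomorphism $\iota(\omega)=(\sigma_0(\omega)\sigma_1(\omega)\dots)$. **Potentials.** $V(\omega)=\log|\phi_{\omega_0}'(\pi(\omega_1\omega_2\dots))|$ on $\Omega$; $W(\omega)=\sum_{i=0}^{\tau_0(\omega)-1}V(T^i\omega)$, regarded as a function on $\Sigma$ via $\iota^{-1}$. It is assumed that, for a fixed $\theta\in(0,1)$: (W1) there is $C_2\in(0,\infty)$ such that for all $n\ge1$, $\sup\{|W(\sigma)-W(\sigma')|:\inf\{j\ge0:\sigma_j\ne\sigma'_j\}=n\}\le C_2\theta^n$. (W2) there is $C_3\in(0,\infty)$ such that $\sum_{n\ge1}\exp(\sup_{\sigma\in[n]}W(\sigma))<C_3$. An *admissible parabolic map* is a map satisfying (H1)-(H5) and (W1)-(W2). **Escape rate.** For a hole $H\subset[0,1]$, $\gamma_\mu(H)=\limsup_{n\to\infty}-\frac1n\log\mu\{x\in[0,1]:F^j(x)\notin H,\ 0\le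 j\le n-1\}$. Here $f\sim g$ means that the ratio $f/g$ tends to $1$ in the indicated limit. The existence of a constant $c_s$ with the stated property for Markov holes is a result of the paper for all admissible parabolic maps. *)

theory Defs
  imports "HOL-Analysis.Analysis" "HOL-Library.Landau_Symbols"
begin

section \<open>One-dimensional calculus\<close>

text \<open>At endpoints contained in \<open>S\<close> the derivatives are one-sided.  Continuity of the derivative
  of order \<open>k\<close> is demanded for all finite \<open>k \<le> r\<close>, so that \<open>r = \<infinity>\<close> gives smooth functions.\<close>

definition Cr_on :: "enat \<Rightarrow> (real \<Rightarrow> real) \<Rightarrow> real set \<Rightarrow> bool" where
  "Cr_on r f S \<longleftrightarrow> (\<exists>D :: nat \<Rightarrow> real \<Rightarrow> real.
     (\<forall>x\<in>S. D 0 x = f x) \<and>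
     (\<forall>k. enat (Suc k) \<le> r \<longrightarrow>
        (\<forall>x\<in>S. (D k has_real_derivative D (Suc k) x) (at x within S))) \<and>
     (\<forall>k. enat k \<le> r \<longrightarrow> continuous_on S (D k)))"

definition extend_continuously ::
  "'a :: topological_space set \<Rightarrow> ('a \<Rightarrow> 'b :: t2_space) \<Rightarrow> 'a \<Rightarrow> 'b" where
  "extend_continuously S f x = (if x \<in> S then f x else Lim (at x within S) f)"

section \<open>Two-branched interval maps\<close>

text \<open>The symbols 0 and 1 are represented by \<^const>\<open>False\<close> and \<^const>\<open>True\<close>.\<close>

definition branch_dom :: "real \<Rightarrow> bool \<Rightarrow> real set" where
  "branch_dom a b = (if b then {a<..1} else {0..a})"

definition inverse_branch :: "(real \<Rightarrow> real) \<Rightarrow> real \<Rightarrow> bool \<Rightarrow> real \<Rightarrow> real" where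
  "inverse_branch F a b =
     extend_continuously (F ` branch_dom a b) (the_inv_into (branch_dom a b) F)"

fun markov_point :: "(real \<Rightarrow> real) \<Rightarrow> real \<Rightarrow> nat \<Rightarrow> real" where
  "markov_point F a 0 = 1"
| "markov_point F a (Suc 0) = a"
| "markov_point F a (Suc (Suc n)) = inverse_branch F a False (markov_point F a (Suc n))"

definition markov_hole :: "(real \<Rightarrow> real) \<Rightarrow> real \<Rightarrow> nat \<Rightarrow> real set" where
  "markov_hole F a N = {0..markov_point F a N}"

section \<open>Measures\<close>

definition leb01 :: "real measure" where
  "leb01 = restrict_space lborel {0..1}"

definition invariant_measure :: "'a measure \<Rightarrow> ('a \<Rightarrow> 'a) \<Rightarrow> bool" where
  "invariant_measure M F \<longleftrightarrow> F \<in> measurable M M \<and>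
     (\<forall>A\<in>sets M. emeasure M (F -` A \<inter> space M) = emeasure M A)"

definition ergodic_measure :: "'a measure \<Rightarrow> ('a \<Rightarrow> 'a) \<Rightarrow> bool" where
  "ergodic_measure M F \<longleftrightarrow>
     (\<forall>A\<in>sets M. F -` A \<inter> space M = A \<longrightarrow>
        emeasure M A = 0 \<or> emeasure M (space M - A) = 0)"

text \<open>Conservativity: wandering sets are null sets.\<close>

definition conservative_measure :: "'a measure \<Rightarrow> ('a \<Rightarrow> 'a) \<Rightarrow> bool" where
  "conservative_measure M F \<longleftrightarrow>
     (\<forall>A\<in>sets M. disjoint_family (\<lambda>n. (F ^^ n) -` A \<inter> space M) \<longrightarrow> emeasure M A = 0)"

definition has_density_bounded_below :: "real measure \<Rightarrow> bool" where
  "has_density_bounded_below M \<longleftrightarrow>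
     (\<exists>h\<in>borel_measurable leb01. M = density leb01 h \<and>
        (\<exists>\<delta>>0. AE x in leb01. ennreal \<delta> \<le> h x))"

definition natural_measure :: "(real \<Rightarrow> real) \<Rightarrow> real measure \<Rightarrow> bool" where
  "natural_measure F M \<longleftrightarrow> sigma_finite_measure M \<and> invariant_measure M F \<and>
     ergodic_measure M F \<and> conservative_measure M F \<and> has_density_bounded_below M"

section \<open>Symbolic coding\<close>

definition shift :: "(nat \<Rightarrow> 'a) \<Rightarrow> nat \<Rightarrow> 'a" where
  "shift \<omega> = (\<lambda>i. \<omega> (Suc i))"

definition itineraries :: "(real \<Rightarrow> real) \<Rightarrow> real \<Rightarrow> (nat \<Rightarrow> bool) set" where
  "itineraries F a = {\<omega>. \<exists>x\<in>{0..1}. \<forall>i. (F ^^ i) x \<in> branch_dom a (\<omega> i)}"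

text \<open>The space of 0-1 strings carries the product topology of the instance for functions.\<close>

definition coding :: "(real \<Rightarrow> real) \<Rightarrow> real \<Rightarrow> (nat \<Rightarrow> bool) \<Rightarrow> real" where
  "coding F a = extend_continuously (itineraries F a)
     (\<lambda>\<omega>. THE x. x \<in> {0..1} \<and> (\<forall>i. (F ^^ i) x \<in> branch_dom a (\<omega> i)))"

fun return_time :: "(nat \<Rightarrow> bool) \<Rightarrow> nat \<Rightarrow> nat" where
  "return_time \<omega> 0 = 1 + Inf {i. \<omega> i}"
| "return_time \<omega> (Suc k) = 1 + Inf {i. return_time \<omega> k \<le> i \<and> \<omega> i}"

definition Omega0 :: "(nat \<Rightarrow> bool) set" where
  "Omega0 = UNIV - (\<Union>i. {\<omega>. (shift ^^ i) \<omega> = (\<lambda>_. False)})"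

text \<open>The map \<open>\<iota>\<close>; its image of \<^const>\<open>Omega0\<close> is \<open>Sigma_seq\<close>, the sequences of positive integers.\<close>

definition induced_code :: "(nat \<Rightarrow> bool) \<Rightarrow> nat \<Rightarrow> nat" where
  "induced_code \<omega> k =
     (case k of 0 \<Rightarrow> return_time \<omega> 0 | Suc l \<Rightarrow> return_time \<omega> (Suc l) - return_time \<omega> l)"

definition Sigma_seq :: "(nat \<Rightarrow> nat) set" where
  "Sigma_seq = {\<sigma>. \<forall>k. 1 \<le> \<sigma> k}"

definition Sigma_cyl :: "nat \<Rightarrow> (nat \<Rightarrow> nat) set" where
  "Sigma_cyl n = {\<sigma> \<in> Sigma_seq. \<sigma> 0 = n}"

text \<open>The derivative of the inverse branch is one-sided at the endpoints of the unit interval.\<close>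

definition potential_V :: "(real \<Rightarrow> real) \<Rightarrow> real \<Rightarrow> (nat \<Rightarrow> bool) \<Rightarrow> real" where
  "potential_V F a \<omega> =
     ln \<bar>vector_derivative (inverse_branch F a (\<omega> 0))
          (at (coding F a (shift \<omega>)) within {0..1})\<bar>"

definition potential_W :: "(real \<Rightarrow> real) \<Rightarrow> real \<Rightarrow> (nat \<Rightarrow> nat) \<Rightarrow> real" where
  "potential_W F a \<sigma> =
     (let \<omega> = the_inv_into Omega0 induced_code \<sigma>
      in \<Sum>i<return_time \<omega> 0. potential_V F a ((shift ^^ i) \<omega>))"

section \<open>Admissible parabolic maps\<close>

text \<open>
  \<^item> In H2, given H1, an extension of \<open>F\<close> from the open interval automatically agrees
    with \<open>F\<close> at the endpoint \<open>a\<close>, respectively 1.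
  \<^item> In H4, \<open>F'\<close> being increasing on \<open>(0,\<epsilon>\<^sub>0)\<close> presupposes that \<open>F\<close> is differentiable there.
    This never holds at \<open>a\<close>, since \<open>F\<close> drops from 1 to 0 there or turns from increasing to
    decreasing; hence \<open>\<epsilon>\<^sub>0 \<le> a\<close>.
    The bound for \<open>\<bar>F'\<bar>\<close> is stated where the two-sided derivative exists, and passes to
    the one-sided derivatives at \<open>a\<close> and 1 by continuity.
  \<^item> In H5, uniqueness is meant up to a positive constant factor, as no normalisation is
    available for infinite measures.
  \<^item> In W, the infimum is taken in the extended naturals, so it is \<open>\<infinity>\<close> for \<open>\<sigma> = \<sigma>'\<close>.
    As suprema and infinite sums of reals are junk values unless finite, boundedness and
    summability are explicit in the second condition.
\<close>

locale admissible_parabolic_map =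
  fixes F :: "real \<Rightarrow> real" and a s :: real and \<mu> :: "real measure"
  assumes maps_to: "F ` {0..1} \<subseteq> {0..1}"
    and H1: "0 < a" "a < 1"
      "\<forall>b. mono_on (branch_dom a b) F \<or> antimono_on (branch_dom a b) F"
      "F ` branch_dom a False = {0..1}" "closure (F ` branch_dom a True) = {0..1}"
    and H2: "\<exists>r::enat. 1 \<le> r \<and>
        Cr_on r F {0<..<a} \<and> (\<exists>g. (\<forall>x\<in>{0<..<a}. g x = F x) \<and> Cr_on r g {0<..a}) \<and>
        Cr_on r F {a<..<1} \<and> (\<exists>g. (\<forall>x\<in>{a<..<1}. g x = F x) \<and> Cr_on r g {a..1})"
    and H3: "F 0 = 0" "0 < s"
      "\<exists>c>0. (\<lambda>x. deriv F x - 1) \<sim>[at_right 0] (\<lambda>x. c * x powr s)"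
    and H4: "\<exists>\<epsilon>\<^sub>0 \<beta>. 0 < \<epsilon>\<^sub>0 \<and> \<epsilon>\<^sub>0 \<le> a \<and> 1 < \<beta> \<and> mono_on {0<..<\<epsilon>\<^sub>0} (deriv F) \<and>
        (\<forall>x\<in>{\<epsilon>\<^sub>0..<1} - {a}. \<beta> \<le> \<bar>deriv F x\<bar>)"
    and H5: "natural_measure F \<mu>"
      "\<forall>\<nu>. natural_measure F \<nu> \<longrightarrow> (\<exists>k>0. \<nu> = scale_measure (ennreal k) \<mu>)"
    and W: "\<exists>\<theta>\<in>{0<..<1}.
        (\<exists>C\<^sub>2>0. \<forall>n\<ge>1. \<forall>\<sigma>\<in>Sigma_seq. \<forall>\<sigma>'\<in>Sigma_seq.
           (INF j\<in>{j. \<sigma> j \<noteq> \<sigma>' j}. enat j) = enat n \<longrightarrow>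
             \<bar>potential_W F a \<sigma> - potential_W F a \<sigma>'\<bar> \<le> C\<^sub>2 * \<theta> ^ n) \<and>
        (\<exists>C\<^sub>3>0. (\<forall>n\<ge>1. bdd_above (potential_W F a ` Sigma_cyl n)) \<and>
           summable (\<lambda>n. exp (SUP \<sigma>\<in>Sigma_cyl (Suc n). potential_W F a \<sigma>)) \<and>
           (\<Sum>n. exp (SUP \<sigma>\<in>Sigma_cyl (Suc n). potential_W F a \<sigma>)) < C\<^sub>3)"

section \<open>Escape rates\<close>

definition ln_ennreal :: "ennreal \<Rightarrow> ereal" where
  "ln_ennreal x = (if x = 0 then -\<infinity> else if x = \<infinity> then \<infinity> else ereal (ln (enn2real x)))"

definition survivors :: "(real \<Rightarrow> real) \<Rightarrow> real set \<Rightarrow> nat \<Rightarrow> real set" where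
  "survivors F H n = {x\<in>{0..1}. \<forall>j<n. (F ^^ j) x \<notin> H}"

definition escape_rate :: "(real \<Rightarrow> real) \<Rightarrow> real measure \<Rightarrow> real set \<Rightarrow> ereal" where
  "escape_rate F \<mu> H =
     limsup (\<lambda>n. - ereal (1 / real n) * ln_ennreal (emeasure \<mu> (survivors F H n)))"

definition hole_scale :: "real \<Rightarrow> real set \<Rightarrow> real" where
  "hole_scale s H =
     (if s < 1 then measure leb01 H
      else if s = 1 then measure leb01 H / (- ln (measure leb01 H))
      else measure leb01 H powr s)"

end

theory Submission
  imports Defs
begin

text \<open>
  Enlarging the hole increases the escape rate.  If \<open>a\<^sub>N\<^sub>+\<^sub>1 \<le> \<epsilon> < a\<^sub>N\<close>, then \<open>\<gamma>(H\<^sub>\<epsilon>)\<close> lies between the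
  rates of two consecutive Markov holes.  Since \<open>F(a\<^sub>N\<^sub>+\<^sub>1) = a\<^sub>N\<close> and \<open>F'(x) \<rightarrow> 1\<close> as \<open>x \<rightarrow> 0\<close>,
  consecutive Markov points are asymptotically equal, hence so are the scales of the two holes.
\<close>

section \<open>Monotonicity of the escape rate in the hole\<close>

lemma measure_leb01_atLeastAtMost:
  assumes "0 \<le> t" "t \<le> 1"
  shows "measure leb01 {0..t} = t"
proof -
  have "measure leb01 {0..t} = measure lborel {0..t}"
    unfolding leb01_def using assms by (subst measure_restrict_space) auto
  then show ?thesis using assms by simp
qed

lemma ln_ennreal_mono:
  assumes "x \<le> y"
  shows "ln_ennreal x \<le> ln_ennreal y"
proof (cases "x = 0 \<or> y = \<infinity>")
  case True
  then show ?thesis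
    by (auto simp: ln_ennreal_def)
next
  case False
  then have "0 < enn2real x" "enn2real x \<le> enn2real y" "y \<noteq> 0" "x \<noteq> \<infinity>"
    using assms by (auto simp: enn2real_positive_iff top.not_eq_extremum zero_less_iff_neq_zero
        intro!: enn2real_mono intro: le_less_trans)
  then show ?thesis
    using False by (auto simp: ln_ennreal_def)
qed

lemma sets_survivors:
  assumes F: "F \<in> measurable \<mu> \<mu>" and sp: "space \<mu> = {0..1}" and H: "H \<inter> {0..1} \<in> sets \<mu>"
  shows "survivors F H n \<in> sets \<mu>"
proof -
  have pow: "(F ^^ j) \<in> measurable \<mu> \<mu>" for j
    by (induction j) (auto intro: measurable_compose[OF _ F] simp: comp_def)
  \<comment> \<open>Iterates stay in \<open>{0..1}\<close>, so hitting \<open>H\<close> is the same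
    as hitting \<open>H\<close> cut down to the unit interval. Holes reaching beyond 1 are thus
    covered.\<close>
  have "survivors F H n = space \<mu> - (\<Union>j<n. (F ^^ j) -` (H \<inter> {0..1}) \<inter> space \<mu>)"
    using measurable_space[OF pow] by (auto simp: survivors_def sp)
  moreover have "(F ^^ j) -` (H \<inter> {0..1}) \<inter> space \<mu> \<in> sets \<mu>" for j
    using measurable_sets[OF pow H] .
  ultimately show ?thesis
    by (simp only:) (intro sets.Diff sets.top sets.finite_UN finite_lessThan)
qed

text \<open>Fewer points survive a larger hole, and the factor \<open>- 1 / n\<close> reverses the
  order. Measurability is asked of the smaller hole because its survivor set is the larger of the
  two. At \<open>n = 0\<close> the factor is 0, as \<open>1 / 0 = 0\<close>, so the inequality holds
  there as well.\<close>

lemma escape_rate_mono: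
  assumes F: "F \<in> measurable \<mu> \<mu>" and sp: "space \<mu> = {0..1}" and H: "H \<inter> {0..1} \<in> sets \<mu>"
    and sub: "H \<subseteq> K"
  shows "escape_rate F \<mu> H \<le> escape_rate F \<mu> K"
  unfolding escape_rate_def
proof (intro Limsup_mono always_eventually allI)
  fix n
  have "emeasure \<mu> (survivors F K n) \<le> emeasure \<mu> (survivors F H n)"
    using sub by (intro emeasure_mono sets_survivors F sp H) (auto simp: survivors_def)
  then have "ln_ennreal (emeasure \<mu> (survivors F K n)) \<le> ln_ennreal (emeasure \<mu> (survivors F H n))"
    by (rule ln_ennreal_mono)
  then have "ereal (1 / real n) * ln_ennreal (emeasure \<mu> (survivors F K n))
      \<le> ereal (1 / real n) * ln_ennreal (emeasure \<mu> (survivors F H n))"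
    by (intro ereal_mult_left_mono) auto
  then show "- ereal (1 / real n) * ln_ennreal (emeasure \<mu> (survivors F H n))
      \<le> - ereal (1 / real n) * ln_ennreal (emeasure \<mu> (survivors F K n))"
    by (simp only: ereal_mult_minus_left ereal_minus_le_minus)
qed

section \<open>From limits along a null sequence to limits at 0 from the right\<close>

lemma null_sequence_bracket:
  fixes p :: "nat \<Rightarrow> real"
  assumes lim: "p \<longlonglongrightarrow> 0" and e: "0 < e" "e < p M"
  obtains N where "M \<le> N" "p (Suc N) \<le> e" "e < p N"
proof -
  have "\<exists>N\<ge>M. p (Suc N) \<le> e \<and> e < p N"
  proof (rule ccontr)
    \<comment> \<open>Without a downward crossing, \<open>e < p N\<close> propagates from
      \<open>M\<close> to all later indices, and the limit 0 would force
      \<open>e <= 0\<close>.\<close>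
    assume "\<not> ?thesis"
    then have step: "e < p N \<Longrightarrow> e < p (Suc N)" if "M \<le> N" for N
      using that by force
    have "e < p N" if "M \<le> N" for N
      using that by (induction rule: dec_induct) (auto intro: e step)
    then have "e \<le> 0"
      by (intro LIMSEQ_le_const[OF lim]) (auto intro: less_imp_le)
    with e show False by simp
  qed
  then show ?thesis using that by blast
qed

text \<open>Here \<open>f\<close> stands for the escape rate, \<open>g\<close> for the scale and
  \<open>p\<close> for the Markov points. On \<open>[p (Suc n), p n)\<close> the quotient is
  squeezed between \<open>f (p (Suc n)) / g (p n)\<close> and
  \<open>f (p n) / g (p (Suc n))\<close>. Both tend to 1, since \<open>ratio\<close> allows the
  denominators to be exchanged. Monotonicity of \<open>g\<close> is confined to \<open>(0,1)\<close>
  because the logarithmic scale is singular at 1.\<close>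

lemma tendsto_ratio_at_right_of_null_sequence:
  fixes f :: "real \<Rightarrow> ereal" and g :: "real \<Rightarrow> real" and p :: "nat \<Rightarrow> real"
  assumes f: "mono f" and g: "mono_on {0<..<1} g" and gpos: "\<And>x. 0 < x \<Longrightarrow> x < 1 \<Longrightarrow> 0 < g x"
    and p: "\<And>n. 0 < p n" "p \<longlonglongrightarrow> 0"
    and ratio: "(\<lambda>n. g (p n) / g (p (Suc n))) \<longlonglongrightarrow> 1"
    and lim: "(\<lambda>n. f (p n) / ereal (g (p n))) \<longlonglongrightarrow> 1"
  shows "((\<lambda>x. f x / ereal (g x)) \<longlongrightarrow> 1) (at_right 0)"
proof -
  have lt1: "\<forall>\<^sub>F n in sequentially. p n < 1"
    using order_tendstoD(2)[OF p(2)] by simp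
  obtain K where K: "\<And>n. K \<le> n \<Longrightarrow> p n < 1"
    using lt1 by (auto simp: eventually_sequentially)
  have gp: "0 < g (p n)" if "K \<le> n" for n
    using gpos p(1) K[OF that] by blast
  have change: "(x / ereal u) * ereal (u / v) = x / ereal v" if "0 < u" "0 < v" for x u v
    using that by (cases x) auto
  have "(\<lambda>n. (f (p n) / ereal (g (p n))) * ereal (g (p n) / g (p (Suc n)))) \<longlonglongrightarrow> 1 * ereal 1"
    using ratio by (intro tendsto_mult_ereal lim) auto
  moreover have "\<forall>\<^sub>F n in sequentially. (f (p n) / ereal (g (p n))) * ereal (g (p n) / g (p (Suc n)))
      = f (p n) / ereal (g (p (Suc n)))"
    by (intro eventually_sequentiallyI[of K] change gp) auto
  ultimately have upper: "(\<lambda>n. f (p n) / ereal (g (p (Suc n)))) \<longlonglongrightarrow> 1"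
    by (auto dest: Lim_transform_eventually)
  have ratio': "(\<lambda>n. g (p (Suc n)) / g (p n)) \<longlonglongrightarrow> 1"
    using tendsto_inverse[OF ratio] by simp
  have "(\<lambda>n. (f (p (Suc n)) / ereal (g (p (Suc n)))) * ereal (g (p (Suc n)) / g (p n)))
      \<longlonglongrightarrow> 1 * ereal 1"
    using ratio' by (intro tendsto_mult_ereal LIMSEQ_Suc[OF lim]) auto
  moreover have "\<forall>\<^sub>F n in sequentially.
      (f (p (Suc n)) / ereal (g (p (Suc n)))) * ereal (g (p (Suc n)) / g (p n))
      = f (p (Suc n)) / ereal (g (p n))"
    by (intro eventually_sequentiallyI[of K] change gp) auto
  ultimately have lower: "(\<lambda>n. f (p (Suc n)) / ereal (g (p n))) \<longlonglongrightarrow> 1"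
    by (auto dest: Lim_transform_eventually)
  \<comment> \<open>Shrinking a positive denominator increases a quotient only if the numerator is
    nonnegative. That sign is read off from the limit 1 being positive.\<close>
  have fpos: "\<forall>\<^sub>F n in sequentially. 0 < f (p n) / ereal (g (p n))"
    using order_tendstoD(1)[OF lim] by simp
  obtain K' where K': "\<And>n. K' \<le> n \<Longrightarrow> 0 < f (p n) / ereal (g (p n))"
    using fpos by (auto simp: eventually_sequentially)
  have f0: "0 \<le> f (p n)" if "K \<le> n" "K' \<le> n" for n
    using K'[OF that(2)] gp[OF that(1)] by (cases "f (p n)") (auto simp: zero_less_divide_iff)
  have div: "x / ereal u \<le> y / ereal v" if "0 \<le> x" "x \<le> y" "0 < v" "v \<le> u" for x y u v
  proof -
    have "x / ereal u \<le> x / ereal v"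
      using that by (cases x) (auto intro: divide_left_mono)
    also have "\<dots> \<le> y / ereal v"
      using that by (intro ereal_divide_right_mono) auto
    finally show ?thesis .
  qed
  have sandwich: "f (p (Suc n)) / ereal (g (p n)) \<le> f x / ereal (g x)"
      "f x / ereal (g x) \<le> f (p n) / ereal (g (p (Suc n)))"
    if n: "K \<le> n" "K' \<le> n" and x: "p (Suc n) \<le> x" "x < p n" for n x
  proof -
    have fx: "f (p (Suc n)) \<le> f x" "f x \<le> f (p n)"
      using x by (auto intro: monoD[OF f])
    have "0 < p (Suc n)" "p n < 1" using p(1) K[OF n(1)] by auto
    then have gx: "0 < g (p (Suc n))" "g (p (Suc n)) \<le> g x" "g x \<le> g (p n)"
      using x by (auto intro!: gpos mono_onD[OF g])
    show "f (p (Suc n)) / ereal (g (p n)) \<le> f x / ereal (g x)"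
      using fx gx n by (intro div f0) auto
    have "0 \<le> f (p (Suc n))"
      using n by (intro f0) auto
    then show "f x / ereal (g x) \<le> f (p n) / ereal (g (p (Suc n)))"
      using fx gx by (intro div) auto
  qed
  \<comment> \<open>Every \<open>x\<close> in \<open>(0, p M)\<close> lies in some
    \<open>[p (Suc N), p N)\<close> with \<open>N >= M\<close>, so a property eventually valid on
    these intervals holds for all small \<open>x > 0\<close>.\<close>
  have ev: "\<forall>\<^sub>F x in at_right 0. P (f x / ereal (g x))"
    if Q: "\<forall>\<^sub>F n in sequentially. \<forall>x. p (Suc n) \<le> x \<longrightarrow> x < p n \<longrightarrow> P (f x / ereal (g x))" for P
  proof -
    obtain M where M: "\<And>n x. \<lbrakk>M \<le> n; p (Suc n) \<le> x; x < p n\<rbrakk> \<Longrightarrow> P (f x / ereal (g x))"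
      using Q by (auto simp: eventually_sequentially)
    show ?thesis
      unfolding eventually_at_right_field
      using null_sequence_bracket[OF p(2), of _ M] p(1)[of M] M by metis
  qed
  show ?thesis
  proof (rule order_tendstoI)
    fix l :: ereal assume "l < 1"
    from order_tendstoD(1)[OF lower this]
    show "\<forall>\<^sub>F x in at_right 0. l < f x / ereal (g x)"
      by (intro ev, elim eventually_rev_mp)
        (auto intro!: eventually_sequentiallyI[of "max K K'"] elim!: less_le_trans intro: sandwich(1))
  next
    fix u :: ereal assume "1 < u"
    from order_tendstoD(2)[OF upper this]
    show "\<forall>\<^sub>F x in at_right 0. f x / ereal (g x) < u"
      by (intro ev, elim eventually_rev_mp)
        (auto intro!: eventually_sequentiallyI[of "max K K'"] intro: le_less_trans[OF sandwich(2)])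
  qed
qed

section \<open>The scale of an interval hole\<close>

lemma hole_scale_interval:
  assumes "0 \<le> t" "t \<le> 1"
  shows "hole_scale s {0..t} = (if s < 1 then t else if s = 1 then t / (- ln t) else t powr s)"
  using assms by (simp add: hole_scale_def measure_leb01_atLeastAtMost)

lemma hole_scale_pos:
  assumes "0 < t" "t < 1"
  shows "0 < hole_scale s {0..t}"
  using assms by (auto simp: hole_scale_interval intro!: divide_pos_neg)

lemma hole_scale_mono: "mono_on {0<..<1} (\<lambda>t. hole_scale s {0..t})"
proof (rule mono_onI)
  fix t u :: real assume tu: "t \<in> {0<..<1}" "u \<in> {0<..<1}" "t \<le> u"
  have "t / (- ln t) \<le> u / (- ln u)"
    using tu by (intro frac_le) auto
  moreover have "t powr s \<le> u powr s" if "1 \<le> s"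
    using tu that by (intro powr_mono2) auto
  ultimately show "hole_scale s {0..t} \<le> hole_scale s {0..u}"
    using tu by (auto simp: hole_scale_interval)
qed

text \<open>All three scales respect asymptotic equality of arguments tending to 0. The powers do so
  by continuity. For the logarithmic scale, \<open>ln (p n)\<close> and \<open>ln (q n)\<close>
  differ by a null sequence while \<open>ln (p n)\<close> diverges, so their quotient tends to
  1.\<close>

lemma hole_scale_ratio:
  fixes p q :: "nat \<Rightarrow> real"
  assumes p: "\<And>n. 0 < p n" "p \<longlonglongrightarrow> 0" and q: "\<And>n. 0 < q n" "q \<longlonglongrightarrow> 0"
    and pq: "(\<lambda>n. p n / q n) \<longlonglongrightarrow> 1"
  shows "(\<lambda>n. hole_scale s {0..p n} / hole_scale s {0..q n}) \<longlonglongrightarrow> 1"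
proof -
  have lt1: "\<forall>\<^sub>F n in sequentially. p n < 1 \<and> q n < 1"
    using order_tendstoD(2)[OF p(2)] order_tendstoD(2)[OF q(2)] by (simp add: eventually_conj)
  have "(\<lambda>n. (p n / q n) powr s) \<longlonglongrightarrow> 1 powr s"
    using pq by (intro tendsto_intros) auto
  then have pow: "(\<lambda>n. p n powr s / q n powr s) \<longlonglongrightarrow> 1"
    using p(1) q(1) by (simp add: powr_divide less_imp_le)
  have "\<forall>\<^sub>F n in sequentially. p n \<in> {0<..} \<and> p n \<noteq> 0"
    using p(1) by (auto simp: less_imp_neq[symmetric])
  then have "filterlim p (at_right 0) sequentially"
    using p(2) by (auto simp: filterlim_at)
  then have lnp: "filterlim (\<lambda>n. ln (p n)) at_bot sequentially"
    by (rule filterlim_compose[OF ln_at_0])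
  have "(\<lambda>n. ln (p n / q n)) \<longlonglongrightarrow> ln 1"
    using pq by (intro tendsto_ln) auto
  then have "(\<lambda>n. ln (p n / q n) / ln (p n)) \<longlonglongrightarrow> 0"
    by (intro tendsto_divide_0[where c = "ln 1"] filterlim_mono[OF lnp at_bot_le_at_infinity]) auto
  \<comment> \<open>The second factor is \<open>ln (q n) / ln (p n)\<close>, rewritten so that its
    limit is visible.\<close>
  then have "(\<lambda>n. (p n / q n) * (1 - ln (p n / q n) / ln (p n))) \<longlonglongrightarrow> 1 * (1 - 0)"
    by (intro tendsto_intros pq)
  moreover have "\<forall>\<^sub>F n in sequentially. (p n / q n) * (1 - ln (p n / q n) / ln (p n))
      = (p n / (- ln (p n))) / (q n / (- ln (q n)))"
    using lt1
  proof eventually_elim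
    case (elim n)
    then have "ln (p n) < 0" "ln (q n) < 0" using p(1) q(1) by auto
    then show ?case using p(1)[of n] q(1)[of n] by (simp add: ln_div field_simps)
  qed
  ultimately have log: "(\<lambda>n. (p n / (- ln (p n))) / (q n / (- ln (q n)))) \<longlonglongrightarrow> 1"
    by (auto dest: Lim_transform_eventually)
  have "\<forall>\<^sub>F n in sequentially.
      (if s < 1 then p n / q n else if s = 1 then (p n / (- ln (p n))) / (q n / (- ln (q n)))
       else p n powr s / q n powr s) = hole_scale s {0..p n} / hole_scale s {0..q n}"
    using lt1
  proof eventually_elim
    case (elim n)
    then show ?case using p(1)[of n] q(1)[of n] by (simp add: hole_scale_interval)
  qed
  moreover have "(\<lambda>n. if s < 1 then p n / q n
      else if s = 1 then (p n / (- ln (p n))) / (q n / (- ln (q n)))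
      else p n powr s / q n powr s) \<longlonglongrightarrow> 1"
    using pq pow log by (cases "s < 1"; cases "s = 1") simp_all
  ultimately show ?thesis
    by (auto dest: Lim_transform_eventually)
qed

section \<open>Continuity and expansion of the left branch\<close>

lemma continuous_on_mono_on_surj:
  fixes f :: "real \<Rightarrow> real"
  assumes ab: "a \<le> b" and f: "mono_on {a..b} f" and im: "f ` {a..b} = {f a..f b}"
  shows "continuous_on {a..b} f"
proof -
  \<comment> \<open>Continuing \<open>f\<close> with slope 1 beyond both endpoints makes its range open.\<close>
  define g where "g x = (if x < a then x - a + f a else if b < x then x - b + f b else f x)" for x
  have bd: "f a \<le> f x" "f x \<le> f b" if "a \<le> x" "x \<le> b" for x
    using that ab by (auto intro!: mono_onD[OF f])
  have "y \<in> range g" for y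
  proof -
    consider "y < f a" | "f b < y" | "y \<in> f ` {a..b}"
      unfolding im by force
    then show ?thesis
    proof cases
      case 1
      then show ?thesis by (intro image_eqI[of _ _ "y - f a + a"]) (auto simp: g_def)
    next
      case 2
      then show ?thesis using ab by (intro image_eqI[of _ _ "y - f b + b"]) (auto simp: g_def)
    next
      case 3
      then obtain x where "a \<le> x" "x \<le> b" "y = f x" by auto
      then show ?thesis by (intro image_eqI[of _ _ x]) (auto simp: g_def)
    qed
  qed
  then have "range g = UNIV" by auto
  moreover have "g x \<le> g y" if "x \<le> y" for x y
    using that ab bd[of x] bd[of y] bd[of a] mono_onD[OF f, of x y]
    by (auto simp: g_def not_less)
  ultimately have "continuous_on UNIV g"
    by (intro continuous_onI_mono) auto
  then have "continuous_on {a..b} g"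
    by (rule continuous_on_subset) simp
  then show ?thesis
    by (rule continuous_on_eq) (auto simp: g_def)
qed

context admissible_parabolic_map
begin

lemma image_left: "F ` {0..a} = {0..1}"
  using H1(4) by (simp add: branch_dom_def)

text \<open>H1 leaves the orientation open. As \<open>F 0 = 0\<close>, a decreasing branch would be
  nonpositive and could not attain 1.\<close>

lemma mono_left: "mono_on {0..a} F"
proof (rule ccontr)
  assume "\<not> ?thesis"
  then have "antimono_on {0..a} F"
    using H1(3)[rule_format, of False] by (auto simp: branch_dom_def)
  then have "F x \<le> 0" if "x \<in> {0..a}" for x
    using that H1(1) H3(1) monotone_onD[of "{0..a}" "(\<le>)" "(\<ge>)" F 0 x] by auto
  moreover obtain x where "x \<in> {0..a}" "F x = 1"
    using image_left by (metis atLeastAtMost_iff imageE order_refl zero_le_one)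
  ultimately show False by force
qed

lemma F_a: "F a = 1"
proof -
  obtain x where x: "x \<in> {0..a}" "F x = 1"
    using image_left by (metis atLeastAtMost_iff imageE order_refl zero_le_one)
  have "F x \<le> F a"
    using x H1(1) by (intro mono_onD[OF mono_left]) auto
  moreover have "F a \<le> 1"
    using maps_to H1 by (auto simp: image_subset_iff)
  ultimately show ?thesis using x by simp
qed

text \<open>H2 says nothing about the endpoint 0. Continuity there, and at \<open>a\<close>, comes
  from monotonicity together with the full range: a jump would leave a gap in the image.\<close>

lemma continuous_left: "continuous_on {0..a} F"
  using H1(1) by (intro continuous_on_mono_on_surj mono_left) (auto simp: image_left H3(1) F_a)

lemma DERIV_left:
  assumes "0 < x" "x < a"
  shows "(F has_real_derivative deriv F x) (at x)"
proof -
  obtain r :: enat where r: "1 \<le> r" "Cr_on r F {0<..<a}"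
    using H2 by auto
  then obtain D where D: "\<forall>x\<in>{0<..<a}. D 0 x = F x"
    "\<forall>x\<in>{0<..<a}. (D 0 has_real_derivative D (Suc 0) x) (at x within {0<..<a})"
    unfolding Cr_on_def by (metis enat_0_iff(2) one_enat_def One_nat_def)
  have "(F has_real_derivative D (Suc 0) x) (at x within {0<..<a})"
    using D assms by (metis greaterThanLessThan_iff has_field_derivative_transform_within zero_less_one)
  then have "(F has_real_derivative D (Suc 0) x) (at x)"
    using assms by (simp add: at_within_open[of _ "{0<..<a}"])
  then show ?thesis
    by (metis DERIV_imp_deriv)
qed

lemma deriv_tendsto_1: "(deriv F \<longlongrightarrow> 1) (at_right 0)"
proof -
  obtain c where c: "0 < c" "(\<lambda>x. deriv F x - 1) \<sim>[at_right 0] (\<lambda>x. c * x powr s)"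
    using H3(3) by auto
  have "((\<lambda>x. c * x powr s) \<longlongrightarrow> c * 0 powr s) (at_right 0)"
    using H3(2) by (intro tendsto_intros tendsto_powr' )
      (auto simp: eventually_at_filter)
  then have "((\<lambda>x. deriv F x - 1) \<longlongrightarrow> 0) (at_right 0)"
    using tendsto_asymp_equiv_cong[OF c(2)] by simp
  then show ?thesis
    by (simp add: LIM_zero_iff)
qed

text \<open>H3 gives the strict bound near 0, and the monotonicity in H4 carries it up to the
  threshold \<open>e\<close>. From \<open>e\<close> on, H4 bounds the absolute value, and the sign
  is positive because \<open>F\<close> increases on the left branch.\<close>

lemma deriv_gt_1:
  assumes "0 < x" "x < a"
  shows "1 < deriv F x"
proof -
  obtain c where c: "0 < c" "(\<lambda>x. deriv F x - 1) \<sim>[at_right 0] (\<lambda>x. c * x powr s)"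
    using H3(3) by auto
  obtain e b where e: "0 < e" "e \<le> a" "1 < b" "mono_on {0<..<e} (deriv F)"
      "\<And>x. x \<in> {e..<1} - {a} \<Longrightarrow> b \<le> \<bar>deriv F x\<bar>"
    using H4 by auto
  have "\<forall>\<^sub>F y in at_right 0. 0 < c * y powr s"
    using c(1) by (auto simp: eventually_at_right_field intro: exI[of _ 1])
  then have "\<forall>\<^sub>F y in at_right 0. 1 < deriv F y"
    using asymp_equiv_eventually_pos_iff[OF c(2)] by eventually_elim auto
  then obtain d where d: "0 < d" "\<And>y. 0 < y \<Longrightarrow> y < d \<Longrightarrow> 1 < deriv F y"
    unfolding eventually_at_right_field by auto
  show ?thesis
  proof (cases "x < e")
    case True
    \<comment> \<open>A comparison point at most \<open>x\<close> that lies in the range where H3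
      gives the bound.\<close>
    define y where "y = min x (d / 2)"
    have y: "0 < y" "y < d" "y \<le> x" using d assms by (auto simp: y_def)
    then have "1 < deriv F y" "deriv F y \<le> deriv F x"
      using d True by (auto intro!: mono_onD[OF e(4)])
    then show ?thesis by simp
  next
    case False
    have "0 \<le> deriv F x"
      using assms by (intro mono_on_imp_deriv_nonneg[OF mono_left DERIV_left]) auto
    then show ?thesis
      using False e(3) e(5)[of x] assms H1 by auto
  qed
qed

lemma strict_mono_left: "strict_mono_on {0..a} F"
proof (rule strict_mono_onI)
  fix x y assume xy: "x \<in> {0..a}" "y \<in> {0..a}" "x < y"
  show "F x < F y"
  proof (rule DERIV_pos_imp_increasing_open[OF xy(3)])
    fix z assume "x < z" "z < y"
    then have "0 < z" "z < a" using xy by auto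
    then show "\<exists>d. DERIV F z :> d \<and> d > 0"
      using DERIV_left deriv_gt_1 by force
  qed (use xy in \<open>auto intro: continuous_on_subset[OF continuous_left]\<close>)
qed

text \<open>\<open>F x - x\<close> vanishes at 0 and has positive derivative. Hence 0 is the only
  fixed point in \<open>{0..a}\<close>, which forces the Markov points down to 0.\<close>

lemma F_gt_id:
  assumes "0 < x" "x \<le> a"
  shows "x < F x"
proof -
  have "F 0 - 0 < F x - x"
  proof (rule DERIV_pos_imp_increasing_open[OF assms(1)])
    fix z assume "0 < z" "z < x"
    then have z: "0 < z" "z < a" using assms by auto
    then have "((\<lambda>x. F x - x) has_real_derivative deriv F z - 1) (at z)"
      by (auto intro!: derivative_eq_intros DERIV_left)
    then show "\<exists>d. DERIV (\<lambda>x. F x - x) z :> d \<and> d > 0"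
      using deriv_gt_1[OF z] by force
  qed (use assms in \<open>auto intro!: continuous_intros intro: continuous_on_subset[OF continuous_left]\<close>)
  then show ?thesis using H3(1) by simp
qed

text \<open>L'Hopital's rule turns the neutrality of the fixed point, \<open>F' -> 1\<close>, into a
  statement about the ratio of a point and its image, hence of consecutive Markov points.\<close>

lemma F_div_id_tendsto_1: "((\<lambda>x. F x / x) \<longlongrightarrow> 1) (at_right 0)"
proof (rule lhopital_right_0)
  have "(F \<longlongrightarrow> F 0) (at 0 within {0..a})"
    using continuous_left H1(1) by (auto simp: continuous_on_def)
  then show "(F \<longlongrightarrow> 0) (at_right 0)"
    using H1(1) H3(1) by (simp add: at_within_Icc_at_right)
  show "\<forall>\<^sub>F x in at_right 0. (F has_real_derivative deriv F x) (at x)"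
    using H1(1) DERIV_left by (auto simp: eventually_at_right_field)
  show "((\<lambda>x. deriv F x / 1) \<longlongrightarrow> 1) (at_right 0)"
    using deriv_tendsto_1 by simp
  show "\<forall>\<^sub>F x in at_right (0::real). x \<noteq> 0"
    by (auto simp: eventually_at_filter)
qed (auto intro!: always_eventually)

section \<open>Markov points\<close>

lemma inverse_branch_left:
  assumes "0 < y" "y \<le> 1"
  shows "0 < inverse_branch F a False y" "inverse_branch F a False y \<le> a"
    "F (inverse_branch F a False y) = y"
proof -
  \<comment> \<open>The left branch is onto \<open>{0..1}\<close>, so
    \<open>extend_continuously\<close> returns the true inverse and never falls back on
    \<open>Lim\<close>.\<close>
  have eq: "inverse_branch F a False y = the_inv_into {0..a} F y"
    using assms by (simp add: inverse_branch_def extend_continuously_def branch_dom_def image_left)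
  have inj: "inj_on F {0..a}"
    by (rule strict_mono_on_imp_inj_on[OF strict_mono_left])
  have y: "y \<in> F ` {0..a}"
    using assms by (simp add: image_left)
  show F: "F (inverse_branch F a False y) = y"
    unfolding eq by (rule f_the_inv_into_f[OF inj y])
  have "inverse_branch F a False y \<in> {0..a}"
    unfolding eq by (rule the_inv_into_into[OF inj y]) simp
  moreover have "inverse_branch F a False y \<noteq> 0"
    using F H3(1) assms by auto
  ultimately show "0 < inverse_branch F a False y" "inverse_branch F a False y \<le> a"
    by auto
qed

text \<open>Stated for \<open>Suc n\<close> because the point of index 0 is 1, outside the left
  branch. The separate clause defining the point of index 1 fits the recursion since
  \<open>F a = 1\<close>.\<close>

lemma markov_point_Suc:
  "0 < markov_point F a (Suc n) \<and> markov_point F a (Suc n) \<le> a \<and>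
   F (markov_point F a (Suc n)) = markov_point F a n"
proof (induction n)
  case 0
  then show ?case using H1 F_a by simp
next
  case (Suc n)
  then show ?case using inverse_branch_left[of "markov_point F a (Suc n)"] H1 by simp
qed

lemma markov_point_pos: "0 < markov_point F a n"
  using markov_point_Suc by (cases n) auto

text \<open>The points decrease because \<open>F\<close> moves points of \<open>(0,a]\<close> to the
  right. Their limit is a fixed point of \<open>F\<close> in \<open>{0..a}\<close>, hence 0.\<close>

lemma markov_point_tendsto_0: "markov_point F a \<longlonglongrightarrow> 0"
proof -
  have "markov_point F a (Suc n) \<le> markov_point F a n" for n
    using F_gt_id markov_point_Suc[of n] by force
  then have "decseq (markov_point F a)"
    by (rule decseq_SucI)
  then obtain L where L: "markov_point F a \<longlonglongrightarrow> L"
    using decseq_convergent[of _ 0] markov_point_pos less_imp_le by metis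
  \<comment> \<open>The shifted sequence stays in \<open>{0..a}\<close>, where \<open>F\<close> is
    continuous; the unshifted one starts at 1.\<close>
  have S: "(\<lambda>n. markov_point F a (Suc n)) \<longlonglongrightarrow> L"
    by (rule LIMSEQ_Suc[OF L])
  have "0 \<le> L" "L \<le> a"
    using markov_point_Suc by (auto intro!: LIMSEQ_le_const[OF S] LIMSEQ_le_const2[OF S] intro: less_imp_le)
  then have "(\<lambda>n. F (markov_point F a (Suc n))) \<longlonglongrightarrow> F L"
    using markov_point_Suc
    by (intro continuous_on_tendsto_compose[OF continuous_left S]) (auto intro!: always_eventually less_imp_le)
  then have "F L = L"
    using markov_point_Suc by (intro LIMSEQ_unique[OF _ L]) simp
  then have "L = 0"
    using F_gt_id[of L] \<open>0 \<le> L\<close> \<open>L \<le> a\<close> by (cases "L = 0") auto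
  with L show ?thesis by simp
qed

lemma markov_point_ratio: "(\<lambda>n. markov_point F a n / markov_point F a (Suc n)) \<longlonglongrightarrow> 1"
proof -
  have "filterlim (\<lambda>n. markov_point F a (Suc n)) (at_right 0) sequentially"
    using LIMSEQ_Suc[OF markov_point_tendsto_0] markov_point_pos
    by (auto simp: filterlim_at less_imp_neq[symmetric])
  from filterlim_compose[OF F_div_id_tendsto_1 this] show ?thesis
    using markov_point_Suc by simp
qed

section \<open>Comparison of general interval holes with Markov holes\<close>

lemma escape_rate_interval_mono: "mono (\<lambda>\<epsilon>. escape_rate F \<mu> {0..\<epsilon>})"
proof (rule monoI)
  fix x y :: real assume "x \<le> y"
  obtain h where "\<mu> = density leb01 h" and F: "F \<in> measurable \<mu> \<mu>"
    using H5(1)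
    unfolding natural_measure_def has_density_bounded_below_def invariant_measure_def by blast
  \<comment> \<open>Passing to a density keeps the space and the measurable sets of
    \<open>leb01\<close>, so interval holes cut down to \<open>{0..1}\<close> are measurable for the
    invariant measure.\<close>
  then have "space \<mu> = {0..1}" "sets \<mu> = sets leb01"
    by (auto simp: leb01_def space_restrict_space)
  then show "escape_rate F \<mu> {0..x} \<le> escape_rate F \<mu> {0..y}"
    using \<open>x \<le> y\<close> by (intro escape_rate_mono F) (auto simp: leb01_def sets_restrict_space_iff)
qed

end

theorem corollary3p7:
  fixes F :: "real \<Rightarrow> real" and a s c\<^sub>s :: real and \<mu> :: "real measure"
  assumes "admissible_parabolic_map F a s \<mu>"
    and "0 < c\<^sub>s"
    and "((\<lambda>N. escape_rate F \<mu> (markov_hole F a N) / ereal (c\<^sub>s * hole_scale s (markov_hole F a N)))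
           \<longlongrightarrow> 1) sequentially"
  shows "((\<lambda>\<epsilon>. escape_rate F \<mu> {0..\<epsilon>} / ereal (c\<^sub>s * hole_scale s {0..\<epsilon>})) \<longlongrightarrow> 1) (at_right 0)"
proof -
  interpret admissible_parabolic_map F a s \<mu>
    by (rule assms(1))
  \<comment> \<open>The constant is absorbed into the scale. Being positive, it preserves
    monotonicity and cancels in the ratio of consecutive scales.\<close>
  let ?p = "markov_point F a" and ?g = "\<lambda>x. c\<^sub>s * hole_scale s {0..x}"
  have "mono_on {0<..<1} ?g"
    using hole_scale_mono[of s] \<open>0 < c\<^sub>s\<close> by (auto simp: monotone_on_def)
  moreover have "(\<lambda>n. ?g (?p n) / ?g (?p (Suc n))) \<longlonglongrightarrow> 1"
    using hole_scale_ratio[OF markov_point_pos markov_point_tendsto_0 markov_point_pos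
        LIMSEQ_Suc[OF markov_point_tendsto_0] markov_point_ratio] \<open>0 < c\<^sub>s\<close> by simp
  ultimately show ?thesis
    using assms(2,3) unfolding markov_hole_def
    by (intro tendsto_ratio_at_right_of_null_sequence[where p = ?p] escape_rate_interval_mono
        markov_point_pos markov_point_tendsto_0 mult_pos_pos hole_scale_pos)
qed

end
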